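(* Let $M\subset I$ be measurable with finite Lebesgue measure. Then $$P_f(M^*,I)\le P_f(M,I).$$
   Context: Let $\alpha\in(0,+\infty]$, $I=(0,\alpha)$, and let $\overline I$ be the closure of $I$ in $\mathbb R$ (so $\overline I=[0,+\infty)$ if $\alpha=+\infty$). The function $f$ satisfies: $f\in C(\overline I)$ and $f(x)>0$ for all $x\in I$; $f(x_2-x_1)\le f(x_1)+f(x_2)$ whenever $x_1,x_2\in\overline I$ with $x_1\le x_2$; and, if $\alpha<+\infty$, also $f(x)=f(\alpha-x)$ for all $x\in\overline I$. For a measurable set $M\subset I$ of finite Lebesgue measure $|M|$, $M^*:=(0,|M|)$ is its decreasing rearrangement. For a measurable set $M\subset I$, the $f$-perimeter of $M$ relative to $I$ is $$P_f(M,I):=\sup\left\{\int_M\varphi'(x)\,dx:\ \varphi\in C^1_0(I),\ |\varphi|\le f\right\}\in[0,+\infty],$$ where $C^1_0(I)$ denotes the $C^1$ functions with compact support in $I$. *)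

theory Defs
  imports "HOL-Analysis.Analysis"
begin

text \<open>Elements of \<open>C\<^sup>1\<^sub>0(I)\<close>, for an open set \<open>I\<close>, are represented by
  their extension by zero to all of \<open>\<real>\<close>.\<close>

definition C1_compact_support :: "real set \<Rightarrow> (real \<Rightarrow> real) set" where
  "C1_compact_support I =
     {\<phi>. \<phi> C1_differentiable_on I \<and>
         compact (closure {x. \<phi> x \<noteq> 0}) \<and> closure {x. \<phi> x \<noteq> 0} \<subseteq> I}"

text \<open>For nonnegative \<open>f\<close> the supremum is over a set containing \<open>0\<close>
  (take \<open>\<phi> = 0\<close>), so it lies in \<open>[0, \<infinity>]\<close>.\<close>

definition f_perimeter :: "(real \<Rightarrow> real) \<Rightarrow> real set \<Rightarrow> real set \<Rightarrow> ereal" where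
  "f_perimeter f M I =
     (SUP \<phi> \<in> {\<phi> \<in> C1_compact_support I. \<forall>x\<in>I. \<bar>\<phi> x\<bar> \<le> f x}.
        ereal (LINT x:M|lebesgue. deriv \<phi> x))"

definition rearrangement :: "real set \<Rightarrow> real set" where
  "rearrangement M = {0<..<measure lebesgue M}"

end

theory Submission
  imports Defs
begin

text \<open>
Write \<open>m\<close> for the measure of \<open>M\<close>. By the fundamental theorem of calculus the derivative
of a test function \<open>\<phi>\<close> has integral \<open>\<phi> m\<close> over the interval from \<open>0\<close> to \<open>m\<close>,
so the perimeter of the rearrangement is at most \<open>f m\<close>, and it vanishes if \<open>m\<close> is an
endpoint of \<open>I\<close>. It remains to show that \<open>f m\<close> is at most the perimeter of \<open>M\<close> when
\<open>m\<close> lies in \<open>I\<close>. This is done by writing down a nearly optimal test function for \<open>M\<close>; no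
structure theory for sets of finite perimeter enters.

Let \<open>\<mu> x\<close> be the measure of the part of \<open>M\<close> to the left of \<open>x\<close>. The function
\<open>\<phi> x = f (\<mu> x) - f (x - \<mu> x)\<close> is admissible, because the hypothesis
\<open>f (x2 - x1) \<le> f x1 + f x2\<close> says precisely that \<open>\<bar>f a - f b\<bar> \<le> f (a + b)\<close>. Moreover
\<open>x - \<mu> x\<close> does not move along \<open>M\<close>, so formally \<open>\<phi>' = f' (\<mu> x) \<mu>' x\<close> on \<open>M\<close>, and the
integral of \<open>\<phi>'\<close> over \<open>M\<close> is \<open>f m - f 0\<close>. Several repairs make this rigorous.

\<^item> \<open>f\<close> is replaced by a \<open>C\<^sup>1\<close> profile \<open>p\<close> (\<open>calibration_profile\<close>): \<open>f - \<eta>\<close> is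
  truncated to \<open>[0, A]\<close> with \<open>A = f m - 2 \<eta>\<close>, cut down to \<open>0\<close> near the origin, and averaged
  over short intervals. None of these operations destroys \<open>\<bar>p a - p b\<bar> \<le> f (a + b)\<close>. Vanishing
  near \<open>0\<close> removes the loss of \<open>f 0\<close> and makes \<open>\<phi>\<close> vanish near \<open>0\<close>; the truncation makes \<open>p\<close>
  constantly \<open>A\<close> near \<open>m\<close>.

\<^item> \<open>\<mu>\<close> is replaced by the antiderivative of a continuous function \<open>u\<close> that agrees with the
  indicator of \<open>M\<close> outside a set of tiny measure (\<open>Urysohn_between_closed_open\<close>), so that
  \<open>\<phi>\<close> is \<open>C\<^sup>1\<close>.

\<^item> \<open>\<phi>\<close> is multiplied by a cutoff \<open>s\<close> that acts where almost all of \<open>M\<close> has been passed.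
  There \<open>p\<close> is flat at \<open>\<mu> x\<close>, so the gain is not affected, and the only cost is the integral
  of \<open>s' \<phi>\<close> over \<open>M\<close>. If \<open>\<alpha>\<close> is finite, the symmetry of \<open>f\<close> makes \<open>p\<close> equal to
  \<open>A\<close> near \<open>\<alpha> - m\<close> as well, so \<open>\<phi> = A - A = 0\<close> near \<open>\<alpha>\<close> already and there is no cost. If
  \<open>\<alpha> = \<infinity>\<close>, the bound \<open>\<bar>\<phi>\<bar> \<le> A\<close> makes the cost a multiple of the measure of a tail of \<open>M\<close>.

The test function is built in \<open>calibrating_test_function\<close>; \<open>f_perimeter_ge\<close> combines it with
the profile and the cutoff, and the two cases for \<open>\<alpha>\<close> choose the parameters.
\<close>

section \<open>Antiderivatives and cutoff functions\<close>

lemma continuous_has_antiderivative: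
  fixes g :: "real \<Rightarrow> real"
  assumes "continuous_on UNIV g"
  obtains G where "\<And>x. (G has_real_derivative g x) (at x)"
proof -
  have "\<And>x. isCont g x"
    using assms continuous_on_eq_continuous_at open_UNIV by blast
  then obtain G where "\<forall>x. -\<infinity> < ereal x \<longrightarrow> ereal x < \<infinity> \<longrightarrow> (G has_vector_derivative g x) (at x)"
    using einterval_antiderivative[of "-\<infinity>" "\<infinity>" g] by auto
  then show thesis
    using that[of G] by (auto simp: has_real_derivative_iff_has_vector_derivative)
qed

lemma increment_le:
  fixes G g :: "real \<Rightarrow> real"
  assumes "a \<le> b" "\<And>x. (G has_real_derivative g x) (at x)"
    and "\<And>x. a \<le> x \<Longrightarrow> x \<le> b \<Longrightarrow> g x \<le> B"
  shows "G b - G a \<le> B * (b - a)"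
proof (cases "a = b")
  case False
  then have "a < b"
    using assms(1) by simp
  then obtain z where "a < z" "z < b" "G b - G a = (b - a) * g z"
    using MVT2[of a b G g] assms(2) by auto
  then show ?thesis
    using assms(3)[of z] \<open>a < b\<close> by (simp add: mult.commute)
qed auto

lemma increment_ge:
  fixes G g :: "real \<Rightarrow> real"
  assumes "a \<le> b" "\<And>x. (G has_real_derivative g x) (at x)"
    and "\<And>x. a \<le> x \<Longrightarrow> x \<le> b \<Longrightarrow> B \<le> g x"
  shows "B * (b - a) \<le> G b - G a"
proof -
  have "(\<lambda>x. - G x) b - (\<lambda>x. - G x) a \<le> - B * (b - a)"
    by (rule increment_le[where g = "\<lambda>x. - g x"]) (use assms in \<open>auto intro: DERIV_minus\<close>)
  then show ?thesis
    by simp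
qed

text \<open>The derivative is a rescaled copy of the truncated parabola \<open>max 0 (6 x (1 - x))\<close>, whose integral
is \<open>1\<close> and whose maximum is \<open>3/2\<close>. That the bound \<open>2 / (b - a)\<close> depends on nothing but the
length of the transition allows a cutoff to be moved far to the right at no cost.\<close>

lemma smooth_cutoff:
  fixes a b :: real
  assumes "a < b"
  obtains s s' :: "real \<Rightarrow> real"
  where "\<And>x. (s has_real_derivative s' x) (at x)" "continuous_on UNIV s'"
    "\<And>x. 0 \<le> s x" "\<And>x. s x \<le> 1" "\<And>x. x \<le> a \<Longrightarrow> s x = 1" "\<And>x. b \<le> x \<Longrightarrow> s x = 0"
    "\<And>x. x \<le> a \<Longrightarrow> s' x = 0" "\<And>x. b \<le> x \<Longrightarrow> s' x = 0" "\<And>x. \<bar>s' x\<bar> \<le> 2 / (b - a)"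
proof -
  define t :: "real \<Rightarrow> real" where "t x = max 0 (6 * x * (1 - x))" for x
  have "continuous_on UNIV t"
    unfolding t_def by (intro continuous_intros)
  then obtain G where G: "\<And>x. (G has_real_derivative t x) (at x)"
    using continuous_has_antiderivative by blast
  have t0: "t x = 0" if "x \<le> 0 \<or> 1 \<le> x" for x
    using that by (auto simp: t_def max_def mult_le_0_iff zero_le_mult_iff)
  have tpos: "0 \<le> t x" for x
    by (simp add: t_def)
  have t2: "t x \<le> 2" for x
  proof -
    have "0 \<le> (x - 1/2)\<^sup>2"
      by simp
    then have "6 * x * (1 - x) \<le> 2"
      by (simp add: power2_eq_square algebra_simps)
    then show ?thesis
      by (simp add: t_def)
  qed
  have left: "G x = G 0" if "x \<le> 0" for x
    using increment_le[of x 0 G t 0] increment_ge[of x 0 G t 0] that G t0 by fastforce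
  have right: "G x = G 1" if "1 \<le> x" for x
    using increment_le[of 1 x G t 0] increment_ge[of 1 x G t 0] that G t0 by fastforce
  have mono: "G x \<le> G y" if "x \<le> y" for x y
    using increment_ge[of x y G t 0] that G tpos by simp
  have one: "G 1 - G 0 = 1"
  proof -
    have "G 1 - (3 * 1\<^sup>2 - 2 * 1 ^ 3) = G 0 - (3 * 0\<^sup>2 - 2 * 0 ^ 3)"
    proof (rule DERIV_isconst_end[where f = "\<lambda>x. G x - (3 * x\<^sup>2 - 2 * x ^ 3)"])
      have "isCont G x" for x
        using G DERIV_isCont by blast
      then show "continuous_on {0..1} (\<lambda>x. G x - (3 * x\<^sup>2 - 2 * x ^ 3))"
        by (intro continuous_intros continuous_at_imp_continuous_on) auto
    next
      fix x :: real assume "0 < x" "x < 1"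
      then have "t x = 6 * x * (1 - x)"
        by (simp add: t_def)
      then show "((\<lambda>x. G x - (3 * x\<^sup>2 - 2 * x ^ 3)) has_real_derivative 0) (at x)"
        using G[of x] by (auto intro!: derivative_eq_intros simp: power2_eq_square algebra_simps)
    qed auto
    then show ?thesis
      by simp
  qed
  define r where "r x = (x - a) / (b - a)" for x
  define s where "s x = 1 - (G (r x) - G 0)" for x
  define s' where "s' x = - (t (r x) / (b - a))" for x
  have r0: "r x \<le> 0" if "x \<le> a" for x
    using that assms by (auto simp: r_def divide_le_0_iff)
  have r1: "1 \<le> r x" if "b \<le> x" for x
    using that assms by (auto simp: r_def field_simps)
  show thesis
  proof
    show "(s has_real_derivative s' x) (at x)" for x
    proof -
      have "(r has_real_derivative 1 / (b - a)) (at x)"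
        unfolding r_def using assms by (auto intro!: derivative_eq_intros)
      from DERIV_chain2[OF G this] show ?thesis
        unfolding s_def s'_def by (auto intro!: derivative_eq_intros)
    qed
    show "continuous_on UNIV s'"
      unfolding s'_def t_def r_def using assms by (intro continuous_intros) auto
    show "s x = 1" if "x \<le> a" for x
      using left[OF r0[OF that]] by (simp add: s_def)
    show "s x = 0" if "b \<le> x" for x
      using right[OF r1[OF that]] one by (simp add: s_def)
    have "G 0 \<le> G y \<and> G y \<le> G 1" for y
      using mono[of 0 y] mono[of y 1] left[of y] right[of y] one by (smt (verit))
    then show "0 \<le> s x" "s x \<le> 1" for x
      using one by (smt (verit) s_def)+
    show "s' x = 0" if "x \<le> a" for x
      using r0[OF that] t0 by (simp add: s'_def)
    show "s' x = 0" if "b \<le> x" for x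
      using r1[OF that] t0 by (simp add: s'_def)
    show "\<bar>s' x\<bar> \<le> 2 / (b - a)" for x
      using tpos t2 assms by (simp add: s'_def divide_right_mono)
  qed
qed

section \<open>A smooth profile that inherits the triangle inequality\<close>

text \<open>The hypothesis on \<open>f\<close> amounts to \<open>\<bar>f a - f b\<bar> \<le> f (a + b)\<close>. Composition with
the 1-Lipschitz truncation of \<open>f - \<eta>\<close> to \<open>[0, A]\<close> keeps it. The damping factor near the origin
keeps it too: if \<open>b\<close> is so small that the damping matters, then \<open>f a - \<eta>\<close> is below
\<open>f (a + b)\<close> by uniform continuity, which is the purpose of subtracting \<open>\<eta>\<close>. A centred
average keeps it because \<open>(a + t) + (b - t) = a + b\<close>: the bound can be averaged over
\<open>t\<close>, and the average of \<open>q (b - t)\<close> is that of \<open>q (b + t)\<close>.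
The average is differentiable even though the averaged function is merely continuous.

The last conclusion is where truncation pays: away from the origin the profile is flat wherever \<open>f\<close>
stays above \<open>A + \<eta>\<close>.\<close>

lemma calibration_profile:
  fixes f :: "real \<Rightarrow> real"
  assumes "0 < T" and cont: "continuous_on {0..T} f"
    and nonneg: "\<And>x. 0 \<le> x \<Longrightarrow> x \<le> T \<Longrightarrow> 0 \<le> f x"
    and tri: "\<And>x1 x2. 0 \<le> x1 \<Longrightarrow> x1 \<le> x2 \<Longrightarrow> x2 \<le> T \<Longrightarrow> f (x2 - x1) \<le> f x1 + f x2"
    and "0 < \<eta>" "0 < \<sigma>" "0 \<le> A"
  obtains p p' :: "real \<Rightarrow> real" and C \<delta> :: real
  where "\<And>x. (p has_real_derivative p' x) (at x)" "continuous_on UNIV p'" "\<And>x. \<bar>p' x\<bar> \<le> C"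
    "\<And>x. 0 \<le> p x" "\<And>x. p x \<le> A" "0 < \<delta>" "\<And>x. x \<le> \<delta> \<Longrightarrow> p x = 0"
    "\<And>a b. 0 \<le> a \<Longrightarrow> 0 \<le> b \<Longrightarrow> a + b \<le> T \<Longrightarrow> \<bar>p a - p b\<bar> \<le> f (a + b)"
    "\<And>x. 2 * \<sigma> \<le> x \<Longrightarrow> x + \<sigma> \<le> T \<Longrightarrow> (\<And>y. \<bar>y - x\<bar> \<le> \<sigma> \<Longrightarrow> A + \<eta> \<le> f y) \<Longrightarrow> p x = A \<and> p' x = 0"
proof -
  \<comment> \<open>Averaging near the ends of \<open>[0, T]\<close> evaluates the function slightly outside; the constant
    extension keeps the modulus of continuity of \<open>f\<close>.\<close>
  define F where "F x = f (max 0 (min T x))" for x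
  have contF: "continuous_on UNIV F"
    unfolding F_def
    by (rule continuous_on_compose2[OF cont]) (use \<open>0 < T\<close> in \<open>auto intro!: continuous_intros\<close>)
  have Ff: "F x = f x" if "0 \<le> x" "x \<le> T" for x
    using that by (simp add: F_def)
  have Fnn: "0 \<le> F x" for x
    unfolding F_def using nonneg \<open>0 < T\<close> by simp
  have "uniformly_continuous_on {0..T} f"
    using cont by (simp add: compact_uniformly_continuous)
  then obtain \<omega> where "0 < \<omega>"
    and \<omega>: "\<And>x y. x \<in> {0..T} \<Longrightarrow> y \<in> {0..T} \<Longrightarrow> dist y x < \<omega> \<Longrightarrow> dist (f y) (f x) < \<eta>"
    using \<open>0 < \<eta>\<close> unfolding uniformly_continuous_on_def by metis
  have modulus: "F y \<le> F x + \<eta>" if "\<bar>y - x\<bar> < \<omega>" for x y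
  proof -
    have "dist (max 0 (min T y)) (max 0 (min T x)) < \<omega>"
      using that by (auto simp: dist_real_def)
    then have "dist (F y) (F x) < \<eta>"
      unfolding F_def using \<omega> \<open>0 < T\<close> by simp
    then show ?thesis
      by (simp add: dist_real_def)
  qed
  define d where "d = min (\<omega> / 2) \<sigma>"
  have d: "0 < d" "d < \<omega>" "d \<le> \<sigma>"
    using \<open>0 < \<omega>\<close> \<open>0 < \<sigma>\<close> by (auto simp: d_def)
  define \<zeta> where "\<zeta> x = max 0 (min 1 (2 * x / d - 1))" for x
  define k where "k x = max 0 (min A (F x - \<eta>))" for x
  define q where "q x = \<zeta> x * k x" for x
  have \<zeta>01: "0 \<le> \<zeta> x" "\<zeta> x \<le> 1" for x
    by (auto simp: \<zeta>_def)
  have \<zeta>0: "\<zeta> x = 0" if "x \<le> d / 2" for x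
    using that d by (simp add: \<zeta>_def field_simps)
  have \<zeta>1: "\<zeta> x = 1" if "d \<le> x" for x
    using that d by (simp add: \<zeta>_def field_simps)
  have k0A: "0 \<le> k x" "k x \<le> A" for x
    using \<open>0 \<le> A\<close> by (auto simp: k_def)
  have q0: "0 \<le> q x" "q x \<le> k x" for x
    using \<zeta>01[of x] k0A[of x] by (auto simp: q_def mult_left_le_one_le)
  have qA: "q x \<le> A" for x
    using q0(2)[of x] k0A(2)[of x] by simp
  have contq: "continuous_on UNIV q"
    unfolding q_def \<zeta>_def k_def using contF d by (intro continuous_intros) auto
  define \<tau> where "\<tau> = d / 4"
  have \<tau>: "0 < \<tau>" "\<tau> < d"
    using d by (auto simp: \<tau>_def)
  \<comment> \<open>\<open>b\<close> may be slightly negative, since averaging shifts nonnegative arguments by up to \<open>\<tau>\<close>.\<close>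
  have qdiff: "q a - q b \<le> F (a + b)" if "0 \<le> a + b" "a + b \<le> T" "- \<tau> \<le> b" for a b
  proof (cases "a \<le> 0")
    case True
    then have "q a = 0"
      using \<zeta>0[of a] d by (simp add: q_def)
    then show ?thesis
      using q0(1)[of b] Fnn[of "a + b"] by simp
  next
    case a: False
    show ?thesis
    proof (cases "b \<le> d")
      case True
      then have "F a \<le> F (a + b) + \<eta>"
        using that d \<tau> by (intro modulus) auto
      then have "k a \<le> F (a + b)"
        using Fnn[of "a + b"] by (auto simp: k_def)
      then show ?thesis
        using q0(2)[of a] q0(1)[of b] by simp
    next
      case False
      have "q b = k b"
        using \<zeta>1[of b] False by (simp add: q_def)
      moreover have "f ((a + b) - b) \<le> f b + f (a + b)"
        using a False that d by (intro tri) auto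
      then have "F a \<le> F b + F (a + b)"
        using a False that d by (simp add: Ff)
      then have "k a - k b \<le> F (a + b)"
        using Fnn[of "a + b"] by (auto simp: k_def)
      ultimately show ?thesis
        using q0(2)[of a] by simp
    qed
  qed
  obtain P where P: "\<And>x. (P has_real_derivative q x) (at x)"
    using continuous_has_antiderivative[OF contq] by blast
  define p where "p x = (P (x + \<tau>) - P (x - \<tau>)) / (2 * \<tau>)" for x
  define p' where "p' x = (q (x + \<tau>) - q (x - \<tau>)) / (2 * \<tau>)" for x
  have p_le: "p x \<le> B" if "\<And>y. \<bar>y - x\<bar> \<le> \<tau> \<Longrightarrow> q y \<le> B" for x B
  proof -
    have "P (x + \<tau>) - P (x - \<tau>) \<le> B * ((x + \<tau>) - (x - \<tau>))"
      using \<tau> that by (intro increment_le[OF _ P]) auto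
    then show ?thesis
      using \<tau> by (simp add: p_def field_simps)
  qed
  have p_ge: "B \<le> p x" if "\<And>y. \<bar>y - x\<bar> \<le> \<tau> \<Longrightarrow> B \<le> q y" for x B
  proof -
    have "B * ((x + \<tau>) - (x - \<tau>)) \<le> P (x + \<tau>) - P (x - \<tau>)"
      using \<tau> that by (intro increment_ge[OF _ P]) auto
    then show ?thesis
      using \<tau> by (simp add: p_def field_simps)
  qed
  have pdiff: "p a - p b \<le> f (a + b)" if "0 \<le> a" "0 \<le> b" "a + b \<le> T" for a b
  proof -
    have "((\<lambda>s. P (a + s) + P (b - s)) has_real_derivative (q (a + s) - q (b - s))) (at s)" for s
    proof -
      have "((\<lambda>s. a + s) has_real_derivative 1) (at s)" "((\<lambda>s. b - s) has_real_derivative - 1) (at s)"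
        by (auto intro!: derivative_eq_intros)
      from DERIV_chain2[OF P this(1)] DERIV_chain2[OF P this(2)] show ?thesis
        by (auto intro!: derivative_eq_intros)
    qed
    moreover have "q (a + s) - q (b - s) \<le> F (a + b)" if "- \<tau> \<le> s" "s \<le> \<tau>" for s
      using qdiff[of "a + s" "b - s"] that \<open>0 \<le> a\<close> \<open>0 \<le> b\<close> \<open>a + b \<le> T\<close> by simp
    ultimately have "(P (a + \<tau>) + P (b - \<tau>)) - (P (a + - \<tau>) + P (b - - \<tau>)) \<le> F (a + b) * (\<tau> - - \<tau>)"
      using \<tau> by (intro increment_le) auto
    moreover have "p a - p b
        = ((P (a + \<tau>) + P (b - \<tau>)) - (P (a + - \<tau>) + P (b - - \<tau>))) / (2 * \<tau>)"
      by (simp add: p_def diff_divide_distrib add_divide_distrib)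
    ultimately have "p a - p b \<le> F (a + b)"
      using \<tau> by (simp add: pos_divide_le_eq)
    then show ?thesis
      using that by (simp add: Ff)
  qed
  show thesis
  proof
    show "(p has_real_derivative p' x) (at x)" for x
    proof -
      have "((\<lambda>x. x + \<tau>) has_real_derivative 1) (at x)" "((\<lambda>x. x - \<tau>) has_real_derivative 1) (at x)"
        by (auto intro!: derivative_eq_intros)
      from DERIV_diff[OF DERIV_chain2[OF P this(1)] DERIV_chain2[OF P this(2)]] show ?thesis
        unfolding p_def p'_def by (intro DERIV_cdivide) simp
    qed
    show "continuous_on UNIV p'"
      unfolding p'_def using \<tau> by (auto intro!: continuous_intros continuous_on_compose2[OF contq])
    show "\<bar>p' x\<bar> \<le> A / (2 * \<tau>)" for x
    proof -
      have "\<bar>q (x + \<tau>) - q (x - \<tau>)\<bar> \<le> A"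
        using q0(1)[of "x + \<tau>"] q0(1)[of "x - \<tau>"] qA[of "x + \<tau>"] qA[of "x - \<tau>"] by simp
      then show ?thesis
        using \<tau> by (simp add: p'_def divide_right_mono)
    qed
    show "0 \<le> p x" for x
      using q0 by (intro p_ge) auto
    show "p x \<le> A" for x
      using qA by (intro p_le) auto
    show "0 < d / 4"
      using d by simp
    show "p x = 0" if "x \<le> d / 4" for x
    proof (rule antisym)
      have "q y = 0" if "\<bar>y - x\<bar> \<le> \<tau>" for y
      proof -
        have "y \<le> d / 2"
          using that \<open>x \<le> d / 4\<close> unfolding \<tau>_def by linarith
        then show ?thesis
          by (simp add: q_def \<zeta>0)
      qed
      then show "p x \<le> 0" "0 \<le> p x"
        by (auto intro!: p_le p_ge)
    qed
    show "\<bar>p a - p b\<bar> \<le> f (a + b)" if "0 \<le> a" "0 \<le> b" "a + b \<le> T" for a b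
      using pdiff[of a b] pdiff[of b a] that by (auto simp: add.commute abs_le_iff)
    show "p x = A \<and> p' x = 0" 
      if x: "2 * \<sigma> \<le> x" "x + \<sigma> \<le> T" and near: "\<And>y. \<bar>y - x\<bar> \<le> \<sigma> \<Longrightarrow> A + \<eta> \<le> f y" for x
    proof -
      have q: "q y = A" if "\<bar>y - x\<bar> \<le> \<tau>" for y
      proof -
        have "\<bar>y - x\<bar> \<le> \<sigma>"
          using that \<tau> d by simp
        then have "A + \<eta> \<le> F y"
          using near[of y] x \<open>0 < \<sigma>\<close> by (subst Ff) auto
        then have "k y = A"
          using \<open>0 \<le> A\<close> by (simp add: k_def)
        moreover have "\<zeta> y = 1"
          using \<open>\<bar>y - x\<bar> \<le> \<sigma>\<close> x d by (intro \<zeta>1) auto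
        ultimately show ?thesis
          by (simp add: q_def)
      qed
      then have "p x \<le> A" "A \<le> p x"
        by (auto intro!: p_le p_ge)
      moreover have "p' x = 0"
        using q[of "x + \<tau>"] q[of "x - \<tau>"] \<tau> by (simp add: p'_def)
      ultimately show ?thesis
        by simp
    qed
  qed
qed

section \<open>Test functions and the perimeter of an initial interval\<close>

lemma has_bochner_integral_FTC_lebesgue:
  fixes G g :: "real \<Rightarrow> real"
  assumes "a \<le> b" "\<And>x. (G has_real_derivative g x) (at x)" "continuous_on UNIV g"
  shows "has_bochner_integral lebesgue (\<lambda>x. g x * indicator {a..b} x) (G b - G a)"
proof -
  have g: "isCont g x" for x
    using assms(3) continuous_on_eq_continuous_at open_UNIV by blast
  have "has_bochner_integral lborel (\<lambda>x. g x * indicator {a..b} x) (G b - G a)"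
    using assms g by (intro has_bochner_integral_FTC_Icc_real)
  then show ?thesis
    by (auto simp: has_bochner_integral_iff integrable_completion integral_completion)
qed

text \<open>Membership in \<open>C1_compact_support I\<close> only speaks of derivatives inside \<open>I\<close>; since the function
vanishes off a compact subset of \<open>I\<close>, it is \<open>C\<^sup>1\<close> on the whole line. This lets the fundamental
theorem of calculus be applied up to the endpoints of \<open>I\<close>.\<close>

lemma compact_support_extension:
  assumes "\<phi> \<in> C1_compact_support I" "open I"
  shows "(\<phi> has_real_derivative deriv \<phi> x) (at x)" "continuous_on UNIV (deriv \<phi>)"
proof -
  let ?S = "closure {x. \<phi> x \<noteq> 0}"
  have S: "compact ?S" "?S \<subseteq> I"
    using assms(1) by (auto simp: C1_compact_support_def)
  obtain D where D: "\<And>x. x \<in> I \<Longrightarrow> (\<phi> has_real_derivative D x) (at x)" "continuous_on I D"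
    using assms(1) 
    by (auto simp: C1_compact_support_def C1_differentiable_on_def has_real_derivative_iff_has_vector_derivative)
  have op: "open (- ?S)"
    by auto
  have out: "(\<phi> has_real_derivative 0) (at x)" if "x \<in> - ?S" for x
  proof (rule has_field_derivative_transform_within_open[OF _ op that])
    show "((\<lambda>x. 0) has_real_derivative 0) (at x)"
      by simp
    show "0 = \<phi> y" if "y \<in> - ?S" for y
      using that closure_subset[of "{x. \<phi> x \<noteq> 0}"] by auto
  qed
  have "\<exists>d. (\<phi> has_real_derivative d) (at y)" for y
    using D(1)[of y] out[of y] S(2) by (cases "y \<in> I") auto
  then show "(\<phi> has_real_derivative deriv \<phi> x) (at x)" for x
    using DERIV_imp_deriv by fastforce
  have "continuous_on I (deriv \<phi>)"
    using D(2) by (rule continuous_on_eq) (simp add: D(1)[THEN DERIV_imp_deriv])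
  moreover have "continuous_on (- ?S) (deriv \<phi>)"
    by (rule continuous_on_eq[where f = "\<lambda>x. 0"]) (simp_all add: out[THEN DERIV_imp_deriv])
  ultimately have "continuous_on (I \<union> - ?S) (deriv \<phi>)"
    using assms(2) op by (intro continuous_on_open_Un)
  moreover have "I \<union> - ?S = UNIV"
    using S(2) by auto
  ultimately show "continuous_on UNIV (deriv \<phi>)"
    by simp
qed

lemma integral_deriv_initial_interval:
  assumes "\<phi> \<in> C1_compact_support I" "open I" "0 \<notin> I" "0 \<le> m"
  shows "(LINT x:{0<..<m}|lebesgue. deriv \<phi> x) = \<phi> m"
proof -
  have "\<phi> 0 = 0"
    using assms(1,3) closure_subset[of "{x. \<phi> x \<noteq> 0}"] by (auto simp: C1_compact_support_def)
  then have *: "has_bochner_integral lebesgue (\<lambda>x. deriv \<phi> x * indicator {0..m} x) (\<phi> m)"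
    using has_bochner_integral_FTC_lebesgue[OF \<open>0 \<le> m\<close> compact_support_extension[OF assms(1,2)]]
    by simp
  have "(LINT x:{0<..<m}|lebesgue. deriv \<phi> x) = (LINT x:{0..m}|lebesgue. deriv \<phi> x)"
  proof (rule set_integral_cong_set)
    have [simp]: "deriv \<phi> \<in> borel_measurable lebesgue"
      using compact_support_extension(2)[OF assms(1,2)]
      by (intro measurable_completion) (simp add: borel_measurable_continuous_onI)
    show "set_borel_measurable lebesgue {0..m} (deriv \<phi>)"
      "set_borel_measurable lebesgue {0<..<m} (deriv \<phi>)"
      unfolding set_borel_measurable_def
      by (intro borel_measurable_scaleR borel_measurable_indicator; simp)+
    have "negligible {0, m}"
      by simp
    then have "AE x in lebesgue. x \<notin> {0, m}"
      by (intro AE_not_in) (simp only: negligible_iff_null_sets)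
    then show "AE x in lebesgue. (x \<in> {0..m}) = (x \<in> {0<..<m})"
      by eventually_elim auto
  qed
  also have "\<dots> = \<phi> m"
    using * by (simp add: has_bochner_integral_iff set_lebesgue_integral_def mult.commute)
  finally show ?thesis .
qed

lemma zero_le_f_perimeter:
  assumes "\<And>x. x \<in> I \<Longrightarrow> 0 \<le> f x"
  shows "0 \<le> f_perimeter f M I"
proof -
  have "(\<lambda>x. 0) \<in> {\<phi> \<in> C1_compact_support I. \<forall>x\<in>I. \<bar>\<phi> x\<bar> \<le> f x}"
    using assms by (auto simp: C1_compact_support_def)
  moreover have "(LINT x:M|lebesgue. deriv (\<lambda>x. 0::real) x) = 0"
    by (simp add: set_lebesgue_integral_def)
  ultimately show ?thesis
    unfolding f_perimeter_def by (intro SUP_upper2[of "\<lambda>x. 0"]) (auto simp: zero_ereal_def)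
qed

section \<open>The nearly optimal test function\<close>

text \<open>A continuous substitute for the indicator of \<open>M\<close>: the two can differ only on \<open>U - K\<close>.\<close>

lemma Urysohn_between_closed_open:
  fixes M :: "real set"
  assumes "M \<in> sets lebesgue" "0 < \<epsilon>"
  obtains K U u where "K \<subseteq> M" "M \<subseteq> U" "U - K \<in> lmeasurable" "measure lebesgue (U - K) < \<epsilon>"
    "continuous_on UNIV u" "\<And>x. 0 \<le> u x" "\<And>x. u x \<le> (1::real)"
    "\<And>x. x \<in> K \<Longrightarrow> u x = 1" "\<And>x. x \<notin> U \<Longrightarrow> u x = 0"
proof -
  have e: "0 < \<epsilon> / 2"
    using assms by simp
  obtain K where K: "closed K" "K \<subseteq> M" "M - K \<in> lmeasurable" "emeasure lebesgue (M - K) < ennreal (\<epsilon> / 2)"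
    using sets_lebesgue_inner_closed[OF assms(1) e] .
  obtain U where U: "open U" "M \<subseteq> U" "U - M \<in> lmeasurable" "emeasure lebesgue (U - M) < ennreal (\<epsilon> / 2)"
    using sets_lebesgue_outer_open[OF assms(1) e] .
  have eq: "U - K = (U - M) \<union> (M - K)"
    using K U by auto
  have "measure lebesgue (U - K) \<le> measure lebesgue (U - M) + measure lebesgue (M - K)"
    unfolding eq using K U by (intro measure_Un_le) auto
  moreover have "measure lebesgue (U - M) < \<epsilon> / 2" "measure lebesgue (M - K) < \<epsilon> / 2"
    using K U e by (simp_all add: emeasure_eq_measure2 ennreal_less_iff)
  ultimately have small: "measure lebesgue (U - K) < \<epsilon>"
    by simp
  obtain u :: "real \<Rightarrow> real" where u: "continuous_on UNIV u"
    "\<And>x. u x \<in> closed_segment 1 0" "\<And>x. x \<in> K \<Longrightarrow> u x = 1" "\<And>x. x \<in> - U \<Longrightarrow> u x = 0"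
  proof (rule Urysohn[of K "- U" 1 "0::real"])
    show "K \<inter> - U = {}"
      using K U by auto
  qed (use K U in auto)
  have "0 \<le> u x" "u x \<le> 1" for x
    using u(2)[of x] by (auto simp: closed_segment_eq_real_ivl)
  then show thesis
    using that[of K U u] K U u small eq by auto
qed

text \<open>On \<open>M\<close> the derivative of \<open>\<phi> x = s x * (p (\<mu> x) - p (x - \<mu> x))\<close> equals the
derivative of \<open>p \<circ> \<mu>\<close>, up to an error carried by a set of small measure, where
\<open>\<mu>' = u\<close> differs from \<open>1\<close>, and up to the cutoff term \<open>s' x * (p (\<mu> x) - p (x - \<mu> x))\<close>, bounded by
\<open>L\<close>. For \<open>x \<ge> a\<close>, where \<open>s\<close> starts to decrease, \<open>\<mu> x\<close> is within \<open>\<sigma>\<close> of \<open>m\<close> by the assumption on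
the tail of \<open>M\<close>, so \<open>p\<close> is flat at \<open>\<mu> x\<close> and the factor \<open>s\<close> does not touch the gain. The gain is
therefore the full increment \<open>A\<close> of \<open>p \<circ> \<mu>\<close>.\<close>

lemma calibrating_test_function:
  fixes p p' s s' :: "real \<Rightarrow> real" and M :: "real set"
  defines "m \<equiv> measure lebesgue M"
  assumes M: "M \<in> lmeasurable" "M \<subseteq> {0<..}" and I: "{0<..b} \<subseteq> I"
    and p: "\<And>x. (p has_real_derivative p' x) (at x)" "continuous_on UNIV p'" "\<And>x. \<bar>p' x\<bar> \<le> C"
      "0 < \<delta>" "\<And>x. x \<le> \<delta> \<Longrightarrow> p x = 0"
    and s: "\<And>x. (s has_real_derivative s' x) (at x)" "continuous_on UNIV s'"
      "\<And>x. 0 \<le> s x" "\<And>x. s x \<le> 1" "\<And>x. x \<le> a \<Longrightarrow> s x = 1" "\<And>x. b \<le> x \<Longrightarrow> s x = 0"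
      "\<And>x. x \<le> a \<Longrightarrow> s' x = 0" "\<And>x. b \<le> x \<Longrightarrow> s' x = 0"
    and ab: "0 < a" "a < b"
    and flat: "\<And>y. \<bar>y - m\<bar> \<le> \<sigma> \<Longrightarrow> p y = A \<and> p' y = 0"
    and tail: "measure lebesgue (M \<inter> {a..}) \<le> \<sigma> / 2"
    and loss: "\<And>x y. a \<le> x \<Longrightarrow> x \<le> b \<Longrightarrow> \<bar>y - m\<bar> \<le> \<sigma> \<Longrightarrow> \<bar>s' x * (p y - p (x - y))\<bar> \<le> L"
    and pos: "0 < \<sigma>" "0 < \<epsilon>" "0 \<le> L"
  obtains \<phi> \<mu> where "\<phi> \<in> C1_compact_support I"
    "\<And>x. \<phi> x = s x * (p (\<mu> x) - p (x - \<mu> x))" "\<And>x. 0 \<le> x \<Longrightarrow> 0 \<le> \<mu> x \<and> \<mu> x \<le> x"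
    "A - L * measure lebesgue (M \<inter> {a..}) - \<epsilon> \<le> (LINT x:M|lebesgue. deriv \<phi> x)"
proof -
  have ind: "integrable lebesgue (indicator S :: real \<Rightarrow> real)" if "S \<in> lmeasurable" for S :: "real set"
    using that by (intro integrable_real_indicator) (auto simp: fmeasurable_def)
  have "0 \<le> C"
    using p(3)[of 0] by simp
  \<comment> \<open>\<open>e\<close> bounds the measure of the set where \<open>u\<close> differs from the indicator of \<open>M\<close>: one bound keeps
    \<open>\<mu>\<close> close to \<open>m\<close>, the other absorbs the error \<open>2 * C\<close> in the derivative.\<close>
  define e where "e = min (\<sigma> / 2) (\<epsilon> / (2 * C + 1))"
  have "0 < e"
    using pos \<open>0 \<le> C\<close> by (simp add: e_def)
  have "M \<in> sets lebesgue"
    using M by auto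
  then obtain K U u where KU: "K \<subseteq> M" "M \<subseteq> U" "U - K \<in> lmeasurable" "measure lebesgue (U - K) < e"
    and u: "continuous_on UNIV u" "\<And>x. 0 \<le> u x" "\<And>x. u x \<le> (1::real)"
      "\<And>x. x \<in> K \<Longrightarrow> u x = 1" "\<And>x. x \<notin> U \<Longrightarrow> u x = 0"
    using Urysohn_between_closed_open[OF _ \<open>0 < e\<close>] by metis
  define G where "G = U - K"
  have G: "G \<in> lmeasurable" "measure lebesgue G < e"
    using KU by (auto simp: G_def)
  have tailM: "M \<inter> {a..} \<in> lmeasurable"
    using M by (intro fmeasurable_Int_fmeasurable) auto
  obtain V where V: "\<And>x. (V has_real_derivative u x) (at x)"
    using continuous_has_antiderivative[OF u(1)] by blast
  define \<mu> where "\<mu> x = V x - V 0" for x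
  have d\<mu>: "(\<mu> has_real_derivative u x) (at x)" for x
    unfolding \<mu>_def using V[of x] by (auto intro!: derivative_eq_intros)
  have \<mu>0: "\<mu> 0 = 0"
    by (simp add: \<mu>_def)
  have \<mu>_nonneg: "0 \<le> \<mu> x \<and> \<mu> x \<le> x" if "0 \<le> x" for x
    using increment_le[OF that d\<mu>, of 1] increment_ge[OF that d\<mu>, of 0] u(2,3) \<mu>0 by simp
  have \<mu>_nonpos: "x \<le> \<mu> x \<and> \<mu> x \<le> 0" if "x \<le> 0" for x
    using increment_le[OF that d\<mu>, of 1] increment_ge[OF that d\<mu>, of 0] u(2,3) \<mu>0 by simp
  have cont\<mu>: "continuous_on UNIV \<mu>"
    using d\<mu> DERIV_isCont by (blast intro: continuous_at_imp_continuous_on)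
  have contp: "continuous_on UNIV p"
    using p(1) DERIV_isCont by (blast intro: continuous_at_imp_continuous_on)
  have conts: "continuous_on UNIV s"
    using s(1) DERIV_isCont by (blast intro: continuous_at_imp_continuous_on)

  have near: "\<bar>\<mu> x - m\<bar> \<le> \<sigma>" if "a \<le> x" for x
  proof -
    have 1: "has_bochner_integral lebesgue (\<lambda>t. u t * indicator {0..x} t) (\<mu> x)"
      using has_bochner_integral_FTC_lebesgue[OF _ d\<mu> u(1), of 0 x] that ab \<mu>0 by simp
    have 2: "has_bochner_integral lebesgue (indicator M) m"
      unfolding m_def using ind[OF M(1)] by (simp add: has_bochner_integral_iff)
    have "\<bar>u t * indicator {0..x} t - indicator M t\<bar> \<le> indicator G t + indicator (M \<inter> {a..}) t" for t
      using KU(1,2) M(2) that ab u(2,3)[of t] u(4,5)[of t] 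
      by (auto simp: G_def indicator_def abs_le_iff)
    then have "norm (LINT t|lebesgue. u t * indicator {0..x} t - indicator M t)
        \<le> (LINT t|lebesgue. indicator G t + indicator (M \<inter> {a..}) t)"
      using 1 2 ind[OF G(1)] ind[OF tailM]
      by (intro Bochner_Integration.integral_norm_bound_integral) (auto simp: has_bochner_integral_iff)
    also have "(LINT t|lebesgue. u t * indicator {0..x} t - indicator M t) = \<mu> x - m"
      using 1 2 by (simp add: has_bochner_integral_iff)
    also have "(LINT t|lebesgue. indicator G t + indicator (M \<inter> {a..}) t :: real)
        = measure lebesgue G + measure lebesgue (M \<inter> {a..})"
      using ind[OF G(1)] ind[OF tailM] by simp
    also have "\<dots> \<le> \<sigma>"
      using G tail by (simp add: e_def)
    finally show ?thesis
      by simp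
  qed

  define \<phi> where "\<phi> x = s x * (p (\<mu> x) - p (x - \<mu> x))" for x
  define \<phi>' where "\<phi>' x = s' x * (p (\<mu> x) - p (x - \<mu> x))
    + s x * (p' (\<mu> x) * u x - p' (x - \<mu> x) * (1 - u x))" for x
  have d\<phi>: "(\<phi> has_real_derivative \<phi>' x) (at x)" for x
  proof -
    have "((\<lambda>x. x - \<mu> x) has_real_derivative (1 - u x)) (at x)"
      using d\<mu>[of x] by (auto intro!: derivative_eq_intros)
    from DERIV_mult[OF s(1) DERIV_diff[OF DERIV_chain2[OF p(1) d\<mu>] DERIV_chain2[OF p(1) this]]]
    show ?thesis
      unfolding \<phi>_def \<phi>'_def by (simp add: algebra_simps)
  qed
  have cont\<phi>': "continuous_on UNIV \<phi>'"
    unfolding \<phi>'_def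
    by (intro continuous_intros continuous_on_compose2[OF contp] continuous_on_compose2[OF p(2)] 
        cont\<mu> conts s(2) u(1)) auto
  have deriv\<phi>: "deriv \<phi> = \<phi>'"
    using d\<phi> DERIV_imp_deriv by blast

  have supp: "{x. \<phi> x \<noteq> 0} \<subseteq> {min \<delta> b..b}"
  proof (rule subsetI, rule ccontr)
    fix x assume x: "x \<in> {x. \<phi> x \<noteq> 0}" "x \<notin> {min \<delta> b..b}"
    have "p (\<mu> x) = 0 \<and> p (x - \<mu> x) = 0" if "x < \<delta>"
      using \<mu>_nonneg[of x] \<mu>_nonpos[of x] that p(4) by (cases "0 \<le> x") (auto intro!: p(5))
    then show False
      using x s(6)[of x] by (auto simp: \<phi>_def)
  qed
  then have cl: "closure {x. \<phi> x \<noteq> 0} \<subseteq> {min \<delta> b..b}"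
    by (intro closure_minimal) auto
  moreover have "{min \<delta> b..b} \<subseteq> I"
    using p(4) ab by (intro order_trans[OF _ I]) auto
  moreover have "compact (closure {x. \<phi> x \<noteq> 0})"
    using cl by (metis bounded_closed_interval bounded_subset closed_closure compact_eq_bounded_closed)
  moreover have "\<phi> C1_differentiable_on I"
    unfolding C1_differentiable_on_def using d\<phi> cont\<phi>'
    by (auto simp: has_real_derivative_iff_has_vector_derivative intro: continuous_on_subset)
  ultimately have C1: "\<phi> \<in> C1_compact_support I"
    by (auto simp: C1_compact_support_def)

  \<comment> \<open>Pointwise comparison with the derivative of \<open>p \<circ> \<mu>\<close>. Off \<open>M\<close> and \<open>G\<close> both sides vanish,
    as \<open>u = 0\<close> there. The term \<open>p' (x - \<mu> x) * (1 - u x)\<close> is the variation of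
    \<open>p (x - \<mu> x)\<close>, and on \<open>M\<close> it survives only on \<open>G\<close>.\<close>
  have low: "p' (\<mu> x) * u x * indicator {0..b} x - 2 * C * indicator G x - L * indicator (M \<inter> {a..}) x
      \<le> indicator M x *\<^sub>R \<phi>' x" for x
  proof (cases "x \<in> M")
    case False
    have "\<bar>p' (\<mu> x)\<bar> * \<bar>u x\<bar> \<le> C * 1"
      using p(3)[of "\<mu> x"] u(2,3)[of x] \<open>0 \<le> C\<close> by (intro mult_mono) auto
    then have "p' (\<mu> x) * u x \<le> C"
      by (simp add: abs_mult[symmetric] abs_le_iff)
    then show ?thesis
      using False \<open>0 \<le> C\<close> KU(1) u(5)[of x] by (auto simp: G_def indicator_def)
  next
    case True
    then have "0 < x"
      using M by auto
    have cut: "s x * p' (\<mu> x) = p' (\<mu> x)"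
      using s(5)[of x] near[of x] flat[of "\<mu> x"] by (cases "x \<le> a") auto
    have "\<bar>p' (x - \<mu> x) * (1 - u x)\<bar> \<le> C * (1 - u x)"
      using p(3)[of "x - \<mu> x"] u(3)[of x] by (simp add: abs_mult mult_right_mono)
    then have "\<bar>s x * (p' (x - \<mu> x) * (1 - u x))\<bar> \<le> 1 * (C * (1 - u x))"
      unfolding abs_mult[of "s x"] using s(3,4)[of x] by (intro mult_mono) auto
    moreover have "C * (1 - u x) \<le> C * indicator G x"
      using True KU(2) u(2,4)[of x] \<open>0 \<le> C\<close> by (intro mult_left_mono) (auto simp: G_def indicator_def)
    ultimately have off: "s x * (p' (x - \<mu> x) * (1 - u x)) \<le> C * indicator G x"
      by simp
    have "\<bar>s' x * (p (\<mu> x) - p (x - \<mu> x))\<bar> \<le> L * indicator (M \<inter> {a..}) x"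
    proof (cases "a \<le> x \<and> x \<le> b")
      case True
      then show ?thesis
        using loss[of x "\<mu> x"] near[of x] \<open>x \<in> M\<close> by simp
    next
      case False
      then have "s' x = 0"
        using s(7,8)[of x] by auto
      then show ?thesis
        using pos by simp
    qed
    moreover have "p' (\<mu> x) * u x * indicator {0..b} x = p' (\<mu> x) * u x"
      using \<open>0 < x\<close> near[of x] flat[of "\<mu> x"] ab by (cases "x \<le> b") auto
    moreover have "\<phi>' x = s' x * (p (\<mu> x) - p (x - \<mu> x))
        + (s x * p' (\<mu> x)) * u x - s x * (p' (x - \<mu> x) * (1 - u x))"
      by (simp add: \<phi>'_def algebra_simps)
    moreover have "0 \<le> C * indicator G x"
      using \<open>0 \<le> C\<close> by simp
    ultimately have "p' (\<mu> x) * u x * indicator {0..b} x - 2 * C * indicator G x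
        - L * indicator (M \<inter> {a..}) x \<le> \<phi>' x"
      using off unfolding cut by linarith
    then show ?thesis
      using True by simp
  qed

  have FTC: "has_bochner_integral lebesgue (\<lambda>x. p' (\<mu> x) * u x * indicator {0..b} x) A"
  proof -
    have "has_bochner_integral lebesgue (\<lambda>x. p' (\<mu> x) * u x * indicator {0..b} x) (p (\<mu> b) - p (\<mu> 0))"
      by (rule has_bochner_integral_FTC_lebesgue)
        (use ab in \<open>auto intro!: DERIV_chain2[OF p(1) d\<mu>] continuous_intros u(1) cont\<mu> 
          continuous_on_compose2[OF p(2)]\<close>)
    moreover have "p (\<mu> b) = A" "p (\<mu> 0) = 0"
      using flat[OF near[of b]] ab \<mu>0 p(4,5) by auto
    ultimately show ?thesis
      by simp
  qed
  have int: "integrable lebesgue (\<lambda>x. indicator M x *\<^sub>R \<phi>' x)"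
  proof -
    have "compact (\<phi>' ` {0..b})"
      using cont\<phi>' by (intro compact_continuous_image) (auto intro: continuous_on_subset)
    then have "bounded (\<phi>' ` {0..b})"
      by (rule compact_imp_bounded)
    then obtain B where B: "\<forall>x\<in>{0..b}. norm (\<phi>' x) \<le> B"
      by (auto simp: bounded_iff)
    have "norm (\<phi>' x) \<le> max B 0" if "x \<in> M" for x
    proof (cases "x \<le> b")
      case True
      then have "x \<in> {0..b}"
        using that M by auto
      then show ?thesis
        using B by (simp add: le_max_iff_disj)
    next
      case False
      then show ?thesis
        using s(6,8)[of x] by (simp add: \<phi>'_def)
    qed
    then show ?thesis
      using M cont\<phi>' 
      by (intro integrableI_bounded_set_indicator[where B = "max B 0"] measurable_completion)
        (auto simp: borel_measurable_continuous_onI fmeasurable_def)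
  qed
  have "A - 2 * C * measure lebesgue G - L * measure lebesgue (M \<inter> {a..})
      = (LINT x|lebesgue. p' (\<mu> x) * u x * indicator {0..b} x - 2 * C * indicator G x
          - L * indicator (M \<inter> {a..}) x)"
    using FTC ind[OF G(1)] ind[OF tailM] by (simp add: has_bochner_integral_iff)
  also have "\<dots> \<le> (LINT x|lebesgue. indicator M x *\<^sub>R \<phi>' x)"
    using FTC ind[OF G(1)] ind[OF tailM] low int by (intro integral_mono) (auto simp: has_bochner_integral_iff)
  also have "\<dots> = (LINT x:M|lebesgue. deriv \<phi> x)"
    by (simp add: deriv\<phi> set_lebesgue_integral_def)
  finally have "A - 2 * C * measure lebesgue G - L * measure lebesgue (M \<inter> {a..})
      \<le> (LINT x:M|lebesgue. deriv \<phi> x)" .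
  moreover have "2 * C * measure lebesgue G \<le> \<epsilon>"
  proof -
    have "2 * C * measure lebesgue G \<le> 2 * C * (\<epsilon> / (2 * C + 1))"
      using G \<open>0 \<le> C\<close> by (intro mult_left_mono) (auto simp: e_def)
    also have "\<dots> \<le> \<epsilon>"
      using \<open>0 \<le> C\<close> pos by (simp add: field_simps)
    finally show ?thesis .
  qed
  ultimately have "A - L * measure lebesgue (M \<inter> {a..}) - \<epsilon> \<le> (LINT x:M|lebesgue. deriv \<phi> x)"
    by simp
  with C1 \<phi>_def \<mu>_nonneg show thesis
    by (rule that)
qed

section \<open>The lower bound for the perimeter\<close>

text \<open>The assumption \<open>cutoff\<close> offers the two ways in which the cutoff between \<open>a\<close> and
\<open>b\<close> can be harmless. Either \<open>f\<close> is above \<open>A + \<eta>\<close> also around \<open>x - m\<close>; then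
\<open>p (\<mu> x) = p (x - \<mu> x) = A\<close>, and the function that is cut off is already zero (right
end of a bounded interval). Or the slope \<open>2 / (b - a)\<close> of the cutoff times the bound \<open>A\<close> of the
function, weighted with the measure of the tail of \<open>M\<close>, is small (unbounded interval).\<close>

lemma f_perimeter_ge:
  fixes f :: "real \<Rightarrow> real" and M :: "real set"
  defines "m \<equiv> measure lebesgue M"
  assumes M: "M \<in> lmeasurable" "M \<subseteq> {0<..}"
    and I: "I \<subseteq> {0<..}" "{0<..b} \<subseteq> I" and ab: "0 < a" "a < b" "b \<le> T"
    and f: "continuous_on {0..T} f" "\<And>x. 0 \<le> x \<Longrightarrow> x \<le> T \<Longrightarrow> 0 \<le> f x"
      "\<And>x1 x2. 0 \<le> x1 \<Longrightarrow> x1 \<le> x2 \<Longrightarrow> x2 \<le> T \<Longrightarrow> f (x2 - x1) \<le> f x1 + f x2"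
    and fI: "\<And>x. x \<in> I \<Longrightarrow> 0 \<le> f x"
    and pos: "0 < \<eta>" "0 < \<sigma>" "0 \<le> A"
    and m: "3 * \<sigma> \<le> m" "m + 2 * \<sigma> \<le> T" "\<And>y. \<bar>y - m\<bar> \<le> 2 * \<sigma> \<Longrightarrow> A + \<eta> \<le> f y"
    and tail: "measure lebesgue (M \<inter> {a..}) \<le> \<sigma> / 2"
    and cutoff: "(\<forall>x\<in>{a..b}. \<forall>z. \<bar>z - (x - m)\<bar> \<le> 2 * \<sigma> \<longrightarrow> \<sigma> \<le> z \<and> z \<le> T \<and> A + \<eta> \<le> f z)
      \<or> 2 / (b - a) * A * measure lebesgue (M \<inter> {a..}) \<le> \<eta>"
  shows "ereal (A - 2 * \<eta>) \<le> f_perimeter f M I"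
proof -
  have "0 < T"
    using ab by simp
  obtain p p' C \<delta> where p: "\<And>x. (p has_real_derivative p' x) (at x)" "continuous_on UNIV p'"
      "\<And>x. \<bar>p' x\<bar> \<le> C" "\<And>x. 0 \<le> p x" "\<And>x. p x \<le> A" "0 < \<delta>" "\<And>x. x \<le> \<delta> \<Longrightarrow> p x = (0::real)"
    and pf: "\<And>a b. 0 \<le> a \<Longrightarrow> 0 \<le> b \<Longrightarrow> a + b \<le> T \<Longrightarrow> \<bar>p a - p b\<bar> \<le> f (a + b)"
    and flat: "\<And>x. 2 * \<sigma> \<le> x \<Longrightarrow> x + \<sigma> \<le> T \<Longrightarrow> (\<And>y. \<bar>y - x\<bar> \<le> \<sigma> \<Longrightarrow> A + \<eta> \<le> f y) \<Longrightarrow> p x = A \<and> p' x = 0"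
    using calibration_profile[OF \<open>0 < T\<close> f pos] by blast
  obtain s s' where s: "\<And>x. (s has_real_derivative s' x) (at x)" "continuous_on UNIV s'"
    "\<And>x. 0 \<le> s x" "\<And>x. s x \<le> (1::real)" "\<And>x. x \<le> a \<Longrightarrow> s x = 1" "\<And>x. b \<le> x \<Longrightarrow> s x = 0"
    "\<And>x. x \<le> a \<Longrightarrow> s' x = 0" "\<And>x. b \<le> x \<Longrightarrow> s' x = 0" 
    and s2: "\<And>x. \<bar>s' x\<bar> \<le> 2 / (b - a)"
    using smooth_cutoff[OF ab(2)] by blast
  have flat_m: "p y = A \<and> p' y = 0" if "\<bar>y - m\<bar> \<le> \<sigma>" for y
    using that m(1,2) by (intro flat m(3)) (auto simp: abs_le_iff)
  obtain L where "0 \<le> L" and L: "L * measure lebesgue (M \<inter> {a..}) \<le> \<eta>"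
    and loss: "\<And>x y. a \<le> x \<Longrightarrow> x \<le> b \<Longrightarrow> \<bar>y - m\<bar> \<le> \<sigma> \<Longrightarrow> \<bar>s' x * (p y - p (x - y))\<bar> \<le> L"
    using cutoff
  proof
    assume filled: "\<forall>x\<in>{a..b}. \<forall>z. \<bar>z - (x - m)\<bar> \<le> 2 * \<sigma> \<longrightarrow> \<sigma> \<le> z \<and> z \<le> T \<and> A + \<eta> \<le> f z"
    have "p (x - y) = A" if "a \<le> x" "x \<le> b" "\<bar>y - m\<bar> \<le> \<sigma>" for x y
    proof -
      have *: "\<sigma> \<le> z \<and> z \<le> T \<and> A + \<eta> \<le> f z" if "\<bar>z - (x - y)\<bar> \<le> \<sigma>" for z
      proof -
        have "\<bar>z - (x - m)\<bar> \<le> 2 * \<sigma>"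
          using that \<open>\<bar>y - m\<bar> \<le> \<sigma>\<close> by linarith
        with filled \<open>a \<le> x\<close> \<open>x \<le> b\<close> show ?thesis
          by auto
      qed
      have "2 * \<sigma> \<le> x - y" "(x - y) + \<sigma> \<le> T"
        using *[of "x - y - \<sigma>"] *[of "x - y + \<sigma>"] pos by auto
      then show ?thesis
        using flat[of "x - y"] * by blast
    qed
    then show thesis
      using that[of 0] flat_m pos by simp
  next
    assume small: "2 / (b - a) * A * measure lebesgue (M \<inter> {a..}) \<le> \<eta>"
    have "\<bar>s' x * (p y - p (x - y))\<bar> \<le> 2 / (b - a) * A" for x y
      unfolding abs_mult
      using s2 p(4)[of y] p(5)[of y] p(4)[of "x - y"] p(5)[of "x - y"] ab
      by (intro mult_mono) (auto simp: abs_le_iff)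
    then show thesis
      using that[of "2 / (b - a) * A"] small pos ab by simp
  qed
  obtain \<phi> \<mu> where \<phi>: "\<phi> \<in> C1_compact_support I"
    "\<And>x. \<phi> x = s x * (p (\<mu> x) - p (x - \<mu> x))" "\<And>x. 0 \<le> x \<Longrightarrow> 0 \<le> \<mu> x \<and> \<mu> x \<le> x"
    and gain: "A - L * measure lebesgue (M \<inter> {a..}) - \<eta> \<le> (LINT x:M|lebesgue. deriv \<phi> x)"
    using calibrating_test_function[OF M I(2) p(1-3) p(6,7) s ab(1,2) _ tail _ pos(2,1) \<open>0 \<le> L\<close>, of A]
      flat_m loss unfolding m_def by blast
  have "\<bar>\<phi> x\<bar> \<le> f x" if "x \<in> I" for x
  proof (cases "x \<le> b")
    case True
    have "0 \<le> x"
      using that I by auto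
    then have "\<bar>p (\<mu> x) - p (x - \<mu> x)\<bar> \<le> f x"
      using \<phi>(3)[of x] True ab pf[of "\<mu> x" "x - \<mu> x"] by simp
    then have "\<bar>s x\<bar> * \<bar>p (\<mu> x) - p (x - \<mu> x)\<bar> \<le> 1 * f x"
      using s(3,4)[of x] by (intro mult_mono) auto
    then show ?thesis
      by (simp add: \<phi>(2) abs_mult)
  next
    case False
    then show ?thesis
      using fI[OF that] s(6)[of x] by (simp add: \<phi>(2))
  qed
  then have "ereal (LINT x:M|lebesgue. deriv \<phi> x) \<le> f_perimeter f M I"
    unfolding f_perimeter_def using \<phi>(1) by (intro SUP_upper) auto
  moreover have "A - 2 * \<eta> \<le> (LINT x:M|lebesgue. deriv \<phi> x)"
    using gain L by simp
  ultimately show ?thesis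
    by (meson ereal_less_eq(3) order_trans)
qed

lemma measure_tail_tendsto_0:
  fixes M :: "real set"
  assumes "M \<in> lmeasurable"
  shows "(\<lambda>n. measure lebesgue (M \<inter> {real n..})) \<longlonglongrightarrow> 0"
proof -
  have "(\<lambda>n. measure lebesgue (M \<inter> {real n..})) \<longlonglongrightarrow> measure lebesgue (\<Inter>n. M \<inter> {real n..})"
  proof (rule Lim_measure_decseq)
    have "M \<inter> {real n..} \<in> lmeasurable" for n
      using assms by (intro fmeasurable_Int_fmeasurable) auto
    then show "range (\<lambda>n. M \<inter> {real n..}) \<subseteq> sets lebesgue" 
      "\<And>n. emeasure lebesgue (M \<inter> {real n..}) \<noteq> \<infinity>"
      using fmeasurableD2 by fastforce+
    show "decseq (\<lambda>n. M \<inter> {real n..})"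
      by (auto simp: decseq_def)
  qed
  moreover have "(\<Inter>n. M \<inter> {real n..}) = {}"
  proof -
    have "\<exists>n. \<not> real n \<le> x" for x
      using reals_Archimedean2[of x] by (auto simp: not_le)
    then show ?thesis
      by auto
  qed
  ultimately show ?thesis
    by simp
qed

section \<open>Rearrangement does not increase the perimeter\<close>

theorem theorem2p3:
  fixes \<alpha> :: ereal and I :: "real set" and f :: "real \<Rightarrow> real" and M :: "real set"
  assumes "0 < \<alpha>"
    and "I = einterval 0 \<alpha>"
    and "continuous_on (closure I) f"
    and "\<And>x. x \<in> I \<Longrightarrow> 0 < f x"
    and "\<And>x1 x2. x1 \<in> closure I \<Longrightarrow> x2 \<in> closure I \<Longrightarrow> x1 \<le> x2 \<Longrightarrow> f (x2 - x1) \<le> f x1 + f x2"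
    and "\<And>a x. \<alpha> = ereal a \<Longrightarrow> x \<in> closure I \<Longrightarrow> f x = f (a - x)"
    and "M \<in> sets lebesgue"
    and "M \<subseteq> I"
    and "emeasure lebesgue M < \<infinity>"
  shows "f_perimeter f (rearrangement M) I \<le> f_perimeter f M I"
proof -
  define m where "m = measure lebesgue M"
  have openI: "open I"
    using assms(2) by simp
  have Ipos: "I \<subseteq> {0<..}"
    using assms(2) by (auto simp: einterval_def)
  have M: "M \<in> lmeasurable" "M \<subseteq> {0<..}"
    using assms(7-9) Ipos by (auto simp: fmeasurable_def)
  have fI: "0 \<le> f x" if "x \<in> I" for x
    using assms(4)[OF that] by simp
  have P0: "0 \<le> f_perimeter f M I"
    using fI by (rule zero_le_f_perimeter)
  have lower: "ereal (f m) \<le> f_perimeter f M I" if mI: "m \<in> I"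
  proof (rule ereal_le_epsilon2)
    fix e :: real assume "0 < e"
    \<comment> \<open>The bound \<open>f m / 2\<close> ensures \<open>0 \<le> A\<close>; \<open>e / 4\<close> pays for the \<open>2 * \<eta>\<close> in \<open>A\<close> and the
      \<open>2 * \<eta>\<close> lost in \<open>f_perimeter_ge\<close>.\<close>
    define \<eta> where "\<eta> = min (e / 4) (f m / 2)"
    define A where "A = f m - 2 * \<eta>"
    have \<eta>: "0 < \<eta>" "0 \<le> A" "4 * \<eta> \<le> e"
      using \<open>0 < e\<close> assms(4)[OF mI] by (auto simp: \<eta>_def A_def)
    have "continuous_on I f"
      using assms(3) closure_subset continuous_on_subset by blast
    then have "isCont f m"
      using mI openI continuous_on_eq_continuous_at by blast
    then obtain d where d: "0 < d" "\<And>y. dist y m < d \<Longrightarrow> dist (f y) (f m) < \<eta>"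
      using \<eta>(1) unfolding continuous_at_eps_delta by blast
    obtain r where r: "0 < r" "ball m r \<subseteq> I"
      using openI mI open_contains_ball by blast
    define \<sigma> where "\<sigma> = min d r / 16"
    have \<sigma>: "0 < \<sigma>"
      using d r by (simp add: \<sigma>_def)
    have "m - 8 * \<sigma> \<in> ball m r" "m + 8 * \<sigma> \<in> ball m r"
      using \<sigma> r d by (auto simp: \<sigma>_def dist_real_def)
    then have mI8: "m - 8 * \<sigma> \<in> I" "m + 8 * \<sigma> \<in> I"
      using r by auto
    then have m8: "8 * \<sigma> < m"
      using Ipos by auto
    have near: "A + \<eta> \<le> f y" if "\<bar>y - m\<bar> \<le> 4 * \<sigma>" for y
    proof -
      have "dist y m < d"
        using that \<sigma> d r by (auto simp: \<sigma>_def dist_real_def)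
      from d(2)[OF this] show ?thesis
        by (simp add: A_def dist_real_def)
    qed
    have "ereal (A - 2 * \<eta>) \<le> f_perimeter f M I"
    proof (cases \<alpha>)
      case (real c)
      have Ic: "I = {0<..<c}" and "0 < c"
        using assms(1,2) real by (auto simp: zero_ereal_def)
      then have clI: "closure I = {0..c}"
        by simp
      have mc: "m + 8 * \<sigma> < c"
        using mI8 Ic by simp
      have sym: "f z = f (c - z)" if "0 \<le> z" "z \<le> c" for z
        using assms(6)[of c z] real that clI by simp
      have f0: "0 \<le> f 0"
        using assms(5)[of 0 m] mI clI Ic by simp
      \<comment> \<open>Positivity is only known inside \<open>I\<close>; at \<open>0\<close> it comes from the triangle inequality, at \<open>c\<close>
        from the symmetry.\<close>
      have nonneg: "0 \<le> f z" if "0 \<le> z" "z \<le> c" for z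
        using that f0 sym[of c] fI[of z] Ic \<open>0 < c\<close> by (cases "z = 0 \<or> z = c") auto
      have tail: "measure lebesgue (M \<inter> {c - \<sigma> / 2..}) \<le> \<sigma> / 2"
      proof -
        have "measure lebesgue (M \<inter> {c - \<sigma> / 2..}) \<le> measure lebesgue {c - \<sigma> / 2..c}"
          using M assms(8) Ic by (intro measure_mono_fmeasurable) auto
        then show ?thesis
          using \<sigma> by simp
      qed
      have "\<sigma> \<le> z \<and> z \<le> c \<and> A + \<eta> \<le> f z"
        if "x \<in> {c - \<sigma> / 2..c - \<sigma> / 4}" "\<bar>z - (x - m)\<bar> \<le> 2 * \<sigma>" for x z
      proof -
        \<comment> \<open>\<open>z\<close> is close to \<open>c - m\<close>, so its mirror image is close to \<open>m\<close>.\<close>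
        have z: "\<bar>(c - z) - m\<bar> \<le> 4 * \<sigma>"
          using that by (auto simp: abs_le_iff)
        then have "\<sigma> \<le> z" "z \<le> c"
          using mc m8 \<sigma> by (auto simp: abs_le_iff)
        then show ?thesis
          using near[OF z] sym[of z] \<sigma> by simp
      qed
      then show ?thesis
        using m8 mc \<sigma> Ic tail near nonneg assms(3,5) clI \<eta>
        by (intro f_perimeter_ge[where T = c and a = "c - \<sigma> / 2" and b = "c - \<sigma> / 4" and \<sigma> = \<sigma>]
            M Ipos) (auto simp: m_def[symmetric] fI)
    next
      case PInf
      have I: "I = {0<..}"
        using assms(2) PInf by (simp add: zero_ereal_def)
      then have clI: "closure I = {0..}"
        by simp
      have f0: "0 \<le> f 0"
        using assms(5)[of 0 m] mI clI I by simp
      have nonneg: "0 \<le> f z" if "0 \<le> z" for z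
        using that f0 fI[of z] I by (cases "z = 0") auto
      \<comment> \<open>Both requirements on the tail at once: \<open>\<sigma> / 2\<close> keeps \<open>\<mu>\<close> in the flat region, the other
        bound makes the cost \<open>2 * A\<close> of a cutoff of length \<open>1\<close> at most \<open>\<eta>\<close>.\<close>
      define e' where "e' = min (\<sigma> / 2) (\<eta> / (2 * A + 1))"
      have "0 < e'"
        using \<sigma> \<eta> by (simp add: e'_def)
      then have "eventually (\<lambda>n. measure lebesgue (M \<inter> {real n..}) < e') sequentially"
        using order_tendstoD(2)[OF measure_tail_tendsto_0[OF M(1)]] by blast
      moreover have "eventually (\<lambda>n. m + 2 * \<sigma> \<le> real n) sequentially"
        using filterlim_real_sequentially by (simp add: filterlim_at_top)
      ultimately obtain n where n: "measure lebesgue (M \<inter> {real n..}) < e'" "m + 2 * \<sigma> \<le> real n"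
        using eventually_happens'[OF sequentially_bot eventually_conj] by blast
      have "2 * A * measure lebesgue (M \<inter> {real n..}) \<le> 2 * A * (\<eta> / (2 * A + 1))"
        using n \<eta> by (intro mult_left_mono) (auto simp: e'_def)
      also have "\<dots> \<le> \<eta>"
        using \<eta> by (simp add: field_simps)
      finally have "2 * A * measure lebesgue (M \<inter> {real n..}) \<le> \<eta>" .
      moreover have "measure lebesgue (M \<inter> {real n..}) \<le> \<sigma> / 2"
        using n by (simp add: e'_def)
      ultimately show ?thesis
        using m8 n(2) \<sigma> I near nonneg assms(3,5) clI \<eta>
        by (intro f_perimeter_ge[where T = "real n + 1" and a = "real n" and b = "real n + 1" and \<sigma> = \<sigma>]
            M Ipos) (auto simp: m_def[symmetric] fI intro: continuous_on_subset)
    next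
      case MInf
      then show ?thesis
        using assms(1) by simp
    qed
    moreover have "f m - e \<le> A - 2 * \<eta>"
      using \<eta> by (simp add: A_def)
    ultimately have "ereal (f m - e) \<le> f_perimeter f M I"
      by (meson ereal_less_eq(3) order_trans)
    then show "ereal (f m) \<le> f_perimeter f M I + ereal e"
      by (cases "f_perimeter f M I") auto
  qed
  show ?thesis
    unfolding f_perimeter_def[of f "rearrangement M"]
  proof (rule SUP_least)
    fix \<phi> assume "\<phi> \<in> {\<phi> \<in> C1_compact_support I. \<forall>x\<in>I. \<bar>\<phi> x\<bar> \<le> f x}"
    then have \<phi>: "\<phi> \<in> C1_compact_support I" "\<And>x. x \<in> I \<Longrightarrow> \<bar>\<phi> x\<bar> \<le> f x"
      by auto
    have eq: "(LINT x:rearrangement M|lebesgue. deriv \<phi> x) = \<phi> m"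
      unfolding rearrangement_def m_def[symmetric]
      using Ipos by (intro integral_deriv_initial_interval[OF \<phi>(1) openI]) (auto simp: m_def)
    show "ereal (LINT x:rearrangement M|lebesgue. deriv \<phi> x) \<le> f_perimeter f M I"
    proof (cases "m \<in> I")
      case True
      then have "ereal (\<phi> m) \<le> ereal (f m)"
        using \<phi>(2)[OF True] by simp
      with lower[OF True] show ?thesis
        unfolding eq by (rule order_trans[rotated])
    next
      case False
      then have "\<phi> m = 0"
        using \<phi>(1) closure_subset[of "{x. \<phi> x \<noteq> 0}"] by (auto simp: C1_compact_support_def)
      then show ?thesis
        using P0 by (simp add: eq zero_ereal_def)
    qed
  qed
qed

end
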